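(* Let $n>2$, $\varepsilon>0$, and let $\Omega\subset S^{n-1}$ be a set of unit vectors that has non-empty intersection with every great $(n-2)$-dimensional sphere of $S^{n-1}$. Let the bodies $K,L\subset\mathbb{E}^n$ belong to the class $\mathcal{K}^\varepsilon_2$ and satisfy $\delta(K,L)<1/\varepsilon$. If for all hyperplanes $P(C,\omega)\in\mathcal{E}_{\Omega,K,L,\varepsilon}$ the images of the corresponding circular projections $f_{C,\omega}(K)$ and $f_{C,\omega}(L)$ coincide, then $K=L$.
   Context: $\mathbb{E}^n$ is $n$-dimensional Euclidean space with unit sphere $S^{n-1}$; $B(C,r)$ is the closed ball; $\mathrm{dist}(x,K)=\inf_{y\in K}\|x-y\|$; $\delta(K,L)=\max\{\max_{x\in K}\mathrm{dist}(x,L),\max_{y\in L}\mathrm{dist}(y,K)\}$ is the Hausdorff distance. A body is a non-empty compact set that equals the closure of its interior. A body $K$ belongs to $\mathcal{K}^\varepsilon_2$ if any point $x\notin K$ belongs to a ball $B$ of radius $1/\varepsilon$ with $\mathrm{int}\,K\cap B=\emptyset$. Circular projection: for $C\in\mathbb{E}^n$ and a unit vector $\omega$, $l(C,\omega)$ is the line through $C$ in direction $\omega$ and $P(C,\omega)$ is the hyperplane through $C$ orthogonal to $\omega$. The circular projection $f_{C,\omega}:\mathbb{E}^n\setminus l(C,\omega)\to P(C,\omega)\setminus\{C\}$ sends $x$ to the point of $S^1_x\cap P(C,\omega)$ nearest to $x$, where $S^1_x$ is the circle through $x$ centered at $C$ in the plane through $C$ parallel to $\overrightarrow{Cx}$ and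 $\omega$; explicitly, for $C$ the origin, $f_{C,\omega}(x)=\frac{\|x\|}{\sqrt{\|x\|^2-(\omega,x)^2}}\,[x-(\omega,x)\omega]$. For a set $A$, $f_{C,\omega}(A)$ denotes the image of $A\setminus l(C,\omega)$. $\mathcal{E}_{\Omega,K,L,\varepsilon}$ is the collection of all hyperplanes $P(C,\omega)$ punctured at $C$ (i.e. pairs $(C,\omega)$) such that $\omega\in\Omega$ and either $\mathrm{dist}(C,K)<2/\varepsilon$ and $P(C,\omega)$ intersects $L$, or $\mathrm{dist}(C,L)\le2/\varepsilon$ and $P(C,\omega)$ intersects $K$. *)

theory Defs
  imports "HOL-Analysis.Analysis"
begin

definition body :: "'a::euclidean_space set \<Rightarrow> bool" where
  "body K \<longleftrightarrow> K \<noteq> {} \<and> compact K \<and> K = closure (interior K)"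

text \<open>For non-empty compact sets the suprema are attained, so they are the maxima of the
  usual definition.\<close>

definition hausdorff_distance :: "'a::euclidean_space set \<Rightarrow> 'a set \<Rightarrow> real" where
  "hausdorff_distance K L = max (SUP x\<in>K. infdist x L) (SUP y\<in>L. infdist y K)"

definition class_K2 :: "real \<Rightarrow> 'a::euclidean_space set set" where
  "class_K2 \<epsilon> = {K. body K \<and>
     (\<forall>x. x \<notin> K \<longrightarrow> (\<exists>c. x \<in> cball c (1 / \<epsilon>) \<and> interior K \<inter> cball c (1 / \<epsilon>) = {}))}"

definition great_sphere :: "nat \<Rightarrow> 'a::euclidean_space set \<Rightarrow> bool" where
  "great_sphere k S \<longleftrightarrow> (\<exists>V. subspace V \<and> dim V = k + 1 \<and> S = sphere 0 1 \<inter> V)"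

definition axis_line :: "'a::euclidean_space \<Rightarrow> 'a \<Rightarrow> 'a set" where
  "axis_line C \<omega> = {C + t *\<^sub>R \<omega> | t. True}"

definition hyperplane :: "'a::euclidean_space \<Rightarrow> 'a \<Rightarrow> 'a set" where
  "hyperplane C \<omega> = {x. \<omega> \<bullet> (x - C) = 0}"

text \<open>The circular projection is only meaningful off \<open>axis_line C \<omega>\<close>, for a unit vector \<open>\<omega>\<close>.\<close>

definition circular_projection :: "'a::euclidean_space \<Rightarrow> 'a \<Rightarrow> 'a \<Rightarrow> 'a" where
  "circular_projection C \<omega> x =
     (let y = x - C in
      C + (norm y / sqrt ((norm y)\<^sup>2 - (\<omega> \<bullet> y)\<^sup>2)) *\<^sub>R (y - (\<omega> \<bullet> y) *\<^sub>R \<omega>))"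

definition circular_image :: "'a::euclidean_space \<Rightarrow> 'a \<Rightarrow> 'a set \<Rightarrow> 'a set" where
  "circular_image C \<omega> A = circular_projection C \<omega> ` (A - axis_line C \<omega>)"

text \<open>A hyperplane punctured at \<open>C\<close> with unit normal \<open>\<omega>\<close> is represented by the pair \<open>(C, \<omega>)\<close>.\<close>

definition punctured_hyperplanes ::
  "'a::euclidean_space set \<Rightarrow> 'a set \<Rightarrow> 'a set \<Rightarrow> real \<Rightarrow> ('a \<times> 'a) set" where
  "punctured_hyperplanes \<Omega> K L \<epsilon> = {(C, \<omega>). \<omega> \<in> \<Omega> \<and>
     (infdist C K < 2 / \<epsilon> \<and> hyperplane C \<omega> \<inter> L \<noteq> {} \<or>
      infdist C L \<le> 2 / \<epsilon> \<and> hyperplane C \<omega> \<inter> K \<noteq> {})}"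

definition axis_circle :: "'a::euclidean_space \<Rightarrow> 'a \<Rightarrow> 'a \<Rightarrow> 'a set" where
  "axis_circle C \<omega> x = {C + v | v. v \<in> span {x - C, \<omega>} \<and> norm v = norm (x - C)}"

text \<open>The explicit formula is the geometric circular projection: the unique nearest point to
  \<open>x\<close> among the points of the hyperplane on the circle through \<open>x\<close> centred at \<open>C\<close> in the
  plane through \<open>C\<close> parallel to \<open>x - C\<close> and \<open>\<omega>\<close>.\<close>

lemma circular_projection_nearest:
  fixes C \<omega> x :: "'a::euclidean_space"
  assumes \<omega>: "norm \<omega> = 1" and x: "x \<notin> axis_line C \<omega>"
  defines "p \<equiv> circular_projection C \<omega> x"
  shows "p \<in> axis_circle C \<omega> x \<inter> hyperplane C \<omega>"
    and "\<And>q. q \<in> axis_circle C \<omega> x \<inter> hyperplane C \<omega> \<Longrightarrow> q \<noteq> p \<Longrightarrow> dist x p < dist x q"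
proof -
  define y u where "y = x - C" and "u = y - (\<omega> \<bullet> y) *\<^sub>R \<omega>"
  have ww: "\<omega> \<bullet> \<omega> = 1" using \<omega> by (simp add: dot_square_norm)
  have "u \<noteq> 0"
  proof
    assume "u = 0"
    then have "x = C + (\<omega> \<bullet> y) *\<^sub>R \<omega>" by (simp add: u_def y_def algebra_simps)
    with x show False unfolding axis_line_def by blast
  qed
  then have nu: "norm u > 0" by simp
  have wu: "\<omega> \<bullet> u = 0" by (simp add: u_def inner_diff_right ww)
  have yu: "y = u + (\<omega> \<bullet> y) *\<^sub>R \<omega>" by (simp add: u_def)
  have uy: "u \<bullet> y = (norm u)\<^sup>2"
    using wu by (subst yu) (simp add: inner_add_right inner_commute power2_norm_eq_inner)
  have "(norm y)\<^sup>2 - (\<omega> \<bullet> y)\<^sup>2 = u \<bullet> u"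
    unfolding power2_norm_eq_inner
    by (simp add: u_def inner_diff_left inner_diff_right ww inner_commute power2_eq_square)
  then have sq: "sqrt ((norm y)\<^sup>2 - (\<omega> \<bullet> y)\<^sup>2) = norm u"
    by (simp add: norm_eq_sqrt_inner)
  define r where "r = norm y / norm u"
  have p: "p = C + r *\<^sub>R u"
    by (simp add: p_def circular_projection_def Let_def flip: y_def)
       (simp add: sq r_def u_def)
  have y0: "y \<noteq> 0" using \<open>u \<noteq> 0\<close> by (auto simp: u_def)
  then have r: "r > 0" using nu by (simp add: r_def)
  have uspan: "u \<in> span {y, \<omega>}"
    unfolding u_def by (intro span_diff span_scale span_base) auto
  have nr: "norm (r *\<^sub>R u) = norm y" using nu by (simp add: r_def)
  show "p \<in> axis_circle C \<omega> x \<inter> hyperplane C \<omega>"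
    using uspan nr wu unfolding axis_circle_def hyperplane_def p
    by (auto simp flip: y_def intro!: span_scale exI[of _ "r *\<^sub>R u"])
  show "dist x p < dist x q"
    if q: "q \<in> axis_circle C \<omega> x \<inter> hyperplane C \<omega>" and qp: "q \<noteq> p" for q
  proof -
    from q obtain v where v: "q = C + v" "v \<in> span {y, \<omega>}" "norm v = norm y" "\<omega> \<bullet> v = 0"
      unfolding axis_circle_def hyperplane_def by (auto simp flip: y_def)
    from v(2) obtain a b where ab: "v = a *\<^sub>R y + b *\<^sub>R \<omega>"
      by (auto simp: span_insert span_singleton algebra_simps)
    have "v = a *\<^sub>R u + (a * (\<omega> \<bullet> y) + b) *\<^sub>R \<omega>"
      unfolding ab u_def by (simp add: algebra_simps)
    moreover from this v(4) have "a * (\<omega> \<bullet> y) + b = 0"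
      by (simp add: inner_add_right wu ww)
    ultimately have va: "v = a *\<^sub>R u" by simp
    with v(3) nu have "\<bar>a\<bar> = r" by (simp add: r_def field_simps)
    with qp p v(1) va have a: "a = - r" by (auto simp: abs_if split: if_splits)
    have "(dist x q)\<^sup>2 - (dist x p)\<^sup>2 = (norm (y - v))\<^sup>2 - (norm (y - r *\<^sub>R u))\<^sup>2"
      by (simp add: v(1) p dist_norm y_def algebra_simps)
    also have "\<dots> = 4 * r * (u \<bullet> y)"
      unfolding va a
      by (simp add: power2_norm_eq_inner inner_diff_left inner_diff_right inner_add_left
          inner_add_right inner_commute)
    also have "\<dots> > 0" using r nu by (simp add: uy)
    finally show ?thesis by (smt (verit) power2_le_imp_le power_mono zero_le_dist)
  qed
qed

end

theory Submission
  imports Defs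
begin

text \<open>A circular projection centred at \<open>C\<close> preserves the distance to \<open>C\<close>. Hence two sets can be
  told apart by their circular images, whatever the direction, as soon as an open ball around
  \<open>C\<close> meets the interior of one set and misses the other: the first image has a
  point inside the ball, the second has none (lemma \<open>circular_image_neqI\<close>).

  If \<open>K \<noteq> L\<close>, the condition defining the class \<open>class_K2 \<epsilon>\<close> supplies such a ball. Since a body is
  the closure of its interior, one of the two bodies, say \<open>A\<close>, has an interior point \<open>x\<close> outside
  the other one, \<open>B\<close>. A ball of radius \<open>1 / \<epsilon>\<close> that contains \<open>x\<close> and no interior point of \<open>B\<close>
  has the required property, and its centre \<open>C\<close> is at distance less than \<open>1 / \<epsilon>\<close> from \<open>A\<close>
  (lemma \<open>class_K2_separating_ball\<close>). It remains to find a direction \<open>\<omega> \<in> \<Omega>\<close> for which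
  \<open>(C, \<omega>)\<close> is admissible, that is, for which the hyperplane through \<open>C\<close> orthogonal to \<open>\<omega>\<close> meets
  \<open>B\<close>. For that, fix any \<open>p \<in> B\<close>: the unit vectors orthogonal to \<open>p - C\<close> contain a great sphere
  of dimension \<open>n - 2\<close>, and \<open>\<Omega>\<close> meets it (lemma \<open>hyperplane_through_point\<close>).\<close>

lemma norm_circular_projection:
  fixes C \<omega> x :: "'a::euclidean_space"
  assumes "norm \<omega> = 1" and "x \<notin> axis_line C \<omega>"
  shows "norm (circular_projection C \<omega> x - C) = norm (x - C)"
  using circular_projection_nearest(1)[OF assms] by (auto simp: axis_circle_def)

lemma interior_axis_line:
  fixes C \<omega> :: "'a::euclidean_space"
  assumes "DIM('a) \<ge> 2"
  shows "interior (axis_line C \<omega>) = {}"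
proof -
  have line: "axis_line C \<omega> = (+) C ` span {\<omega>}"
    by (auto simp: axis_line_def span_singleton)
  have "dim (span {\<omega>}) < DIM('a)"
    using dim_le_card'[of "{\<omega>}"] assms by simp
  then show ?thesis
    by (simp add: line interior_translation empty_interior_lowdim)
qed

text \<open>Only points off the axis are projected, so a single point of \<open>A\<close> inside the ball would not
  suffice; an open set of them does, because the axis has empty interior.\<close>

lemma circular_image_neqI:
  fixes C \<omega> :: "'a::euclidean_space"
  assumes dim: "DIM('a) \<ge> 2" and \<omega>: "norm \<omega> = 1"
    and A: "interior A \<inter> ball C r \<noteq> {}" and B: "B \<inter> ball C r = {}"
  shows "circular_image C \<omega> A \<noteq> circular_image C \<omega> B"
proof
  assume eq: "circular_image C \<omega> A = circular_image C \<omega> B"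
  have "\<not> interior A \<inter> ball C r \<subseteq> axis_line C \<omega>"
    using interior_maximal[of "interior A \<inter> ball C r" "axis_line C \<omega>"]
      interior_axis_line[OF dim, of C \<omega>] A by auto
  then obtain a where a: "a \<in> interior A" "a \<in> ball C r" "a \<notin> axis_line C \<omega>"
    by blast
  have "circular_projection C \<omega> a \<in> circular_image C \<omega> A"
    using a interior_subset[of A] by (auto simp: circular_image_def)
  with eq obtain b where b: "b \<in> B" "b \<notin> axis_line C \<omega>"
      "circular_projection C \<omega> a = circular_projection C \<omega> b"
    by (auto simp: circular_image_def)
  then have "norm (b - C) = norm (a - C)"
    using norm_circular_projection[OF \<omega>] a(3) by metis
  then have "b \<in> ball C r"
    using a(2) by (simp add: dist_norm norm_minus_commute)
  with b(1) B show False by blast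
qed

text \<open>The ball given by the definition of the class is closed, and the given point may lie on its
  boundary. If that point is interior to \<open>A\<close>, the open ball still meets the interior of \<open>A\<close>, while
  \<open>B\<close>, being the closure of its interior, has no point in the open ball.\<close>

lemma class_K2_separating_ball:
  fixes A B :: "'a::euclidean_space set"
  assumes \<epsilon>: "\<epsilon> > 0" and A: "body A" and B: "B \<in> class_K2 \<epsilon>" and AB: "\<not> A \<subseteq> B"
  obtains C where "interior A \<inter> ball C (1 / \<epsilon>) \<noteq> {}" "B \<inter> ball C (1 / \<epsilon>) = {}"
    "infdist C A < 1 / \<epsilon>"
proof -
  have clA: "closure (interior A) = A" and clB: "closure (interior B) = B" and "closed B"
    using A B by (auto simp: body_def class_K2_def compact_imp_closed)
  have "interior A \<inter> - B \<noteq> {}"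
    using AB closure_minimal[OF _ \<open>closed B\<close>, of "interior A"] clA by blast
  then obtain x where x: "x \<in> interior A" "x \<notin> B" by blast
  then obtain C where C: "x \<in> cball C (1 / \<epsilon>)" "interior B \<inter> cball C (1 / \<epsilon>) = {}"
    using B by (auto simp: class_K2_def)
  have "x \<in> closure (ball C (1 / \<epsilon>))"
    using C(1) \<epsilon> by simp
  then have meet: "interior A \<inter> ball C (1 / \<epsilon>) \<noteq> {}"
    using x(1) open_Int_closure_eq_empty[OF open_interior, of A "ball C (1 / \<epsilon>)"] by blast
  have "ball C (1 / \<epsilon>) \<inter> interior B = {}"
    using C(2) by auto
  then have miss: "B \<inter> ball C (1 / \<epsilon>) = {}"
    using open_Int_closure_eq_empty[OF open_ball, of C "1 / \<epsilon>" "interior B"] clB by blast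
  obtain z where z: "z \<in> A" "dist C z < 1 / \<epsilon>"
    using meet interior_subset[of A] by (meson disjoint_iff mem_ball subsetD)
  then have "infdist C A < 1 / \<epsilon>"
    using infdist_le[of z A C] by simp
  with meet miss that show thesis by blast
qed

lemma hyperplane_through_point:
  fixes C p :: "'a::euclidean_space"
  assumes dim: "DIM('a) \<ge> 2"
    and \<Omega>: "\<And>S. great_sphere (DIM('a) - 2) S \<Longrightarrow> \<Omega> \<inter> S \<noteq> {}"
  obtains \<omega> where "\<omega> \<in> \<Omega>" "p \<in> hyperplane C \<omega>"
proof -
  have "\<exists>V. subspace V \<and> dim V = DIM('a) - 1 \<and> (\<forall>\<omega>\<in>V. \<omega> \<bullet> (p - C) = 0)"
  proof (cases "p = C")
    case True
    \<comment> \<open>Every direction is admissible here, so any subspace of the right dimension will do.\<close>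
    have "DIM('a) - 1 \<le> dim (UNIV :: 'a set)" by simp
    then obtain V :: "'a set" where "subspace V" "dim V = DIM('a) - 1"
      using choose_subspace_of_subspace by metis
    with True show ?thesis by auto
  next
    case False
    then have "dim {x. (p - C) \<bullet> x = 0} = DIM('a) - 1"
      by (intro dim_hyperplane) simp
    then show ?thesis
      by (intro exI[of _ "{x. (p - C) \<bullet> x = 0}"]) (simp add: subspace_hyperplane inner_commute[of _ "p - C"])
  qed
  then obtain V :: "'a set" where V: "subspace V" "dim V = DIM('a) - 1"
      "\<And>\<omega>. \<omega> \<in> V \<Longrightarrow> \<omega> \<bullet> (p - C) = 0"
    by blast
  have "great_sphere (DIM('a) - 2) (sphere 0 1 \<inter> V)"
    unfolding great_sphere_def using V dim by (intro exI[of _ V]) auto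
  then obtain \<omega> where "\<omega> \<in> \<Omega>" "\<omega> \<in> V"
    using \<Omega> by blast
  with V(3) that show thesis by (auto simp: hyperplane_def)
qed

theorem theorem6:
  fixes K L \<Omega> :: "'a::euclidean_space set" and \<epsilon> :: real
  assumes "DIM('a) > 2"
    and "\<epsilon> > 0"
    and "\<Omega> \<subseteq> sphere 0 1"
    and "\<And>S. great_sphere (DIM('a) - 2) S \<Longrightarrow> \<Omega> \<inter> S \<noteq> {}"
    and "K \<in> class_K2 \<epsilon>"
    and "L \<in> class_K2 \<epsilon>"
    and "hausdorff_distance K L < 1 / \<epsilon>"
    and "\<And>C \<omega>. (C, \<omega>) \<in> punctured_hyperplanes \<Omega> K L \<epsilon> \<Longrightarrow>
            circular_image C \<omega> K = circular_image C \<omega> L"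
  shows "K = L"
proof -
  have dim: "DIM('a) \<ge> 2" using assms(1) by simp
  have incl: "A \<subseteq> B"
    if A: "A \<in> class_K2 \<epsilon>" and B: "B \<in> class_K2 \<epsilon>"
      and im: "\<And>C \<omega>. \<omega> \<in> \<Omega> \<Longrightarrow> infdist C A < 2 / \<epsilon> \<Longrightarrow> hyperplane C \<omega> \<inter> B \<noteq> {}
                \<Longrightarrow> circular_image C \<omega> A = circular_image C \<omega> B"
    for A B :: "'a set"
  proof (rule ccontr)
    assume "\<not> A \<subseteq> B"
    moreover have "body A" using A by (simp add: class_K2_def)
    ultimately obtain C where C: "interior A \<inter> ball C (1 / \<epsilon>) \<noteq> {}" "B \<inter> ball C (1 / \<epsilon>) = {}"
        "infdist C A < 1 / \<epsilon>"
      using class_K2_separating_ball[OF assms(2) _ B] by metis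
    obtain p where "p \<in> B"
      using B by (auto simp: class_K2_def body_def)
    obtain \<omega> where \<omega>: "\<omega> \<in> \<Omega>" "p \<in> hyperplane C \<omega>"
      using hyperplane_through_point[OF dim assms(4)] by blast
    have "norm \<omega> = 1"
      using \<omega>(1) assms(3) by auto
    moreover have "1 / \<epsilon> \<le> 2 / \<epsilon>"
      using assms(2) by (intro divide_right_mono) auto
    ultimately show False
      using im[OF \<omega>(1), of C] C(3) \<omega>(2) \<open>p \<in> B\<close> circular_image_neqI[OF dim _ C(1,2)] by force
  qed
  \<comment> \<open>The two inclusions use the two alternatives in the definition of the admissible pairs.\<close>
  show ?thesis
  proof
    show "K \<subseteq> L"
      using assms(5,6,8) by (intro incl) (auto simp: punctured_hyperplanes_def)
    show "L \<subseteq> K"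
      using assms(5,6) assms(8)[symmetric]
      by (intro incl) (auto simp: punctured_hyperplanes_def)
  qed
qed

end
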